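(* Let $\psi:\mathbb{R}^n\to\mathbb{R}^n$ be a contraction that is the pointwise limit on $B^n$ of a sequence of finite compositions of contractions associated with polarizations. If the restriction of $\psi$ to $B^n$ is injective, then $\mathcal H^n(\psi(B^n))=\mathcal H^n(B^n)$.
   Context: A contraction is a map with Lipschitz constant $1$. $B^n$ is the closed unit ball. The contraction associated with the polarization with respect to the oriented hyperplane $H=u^\perp+t_0u$ ($u$ a unit vector, positive halfspace $H^+=\{x:\langle x,u\rangle\ge t_0\}$) is $\psi_{P_H}(x)=x+\big(|t_0-\langle x,u\rangle|+(t_0-\langle x,u\rangle)\big)u$, i.e. the identity on $H^+$ and the reflection in $H$ on $H^-$; the hyperplanes may be arbitrary. *)

theory Defs
  imports "HOL-Analysis.Analysis"
begin

text \<open>Contraction associated with the polarization w.r.t. the oriented hyperplane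
  H = u-perp + t0 u (u a unit vector), positive halfspace {x. x \<bullet> u \<ge> t0}.\<close>
definition polarization_map :: "'a::euclidean_space \<Rightarrow> real \<Rightarrow> 'a \<Rightarrow> 'a" where
  "polarization_map u t0 x = x + (\<bar>t0 - x \<bullet> u\<bar> + (t0 - x \<bullet> u)) *\<^sub>R u"

inductive_set polarization_compositions :: "('a::euclidean_space \<Rightarrow> 'a) set" where
  id: "id \<in> polarization_compositions"
| comp: "\<lbrakk>f \<in> polarization_compositions; norm u = 1\<rbrakk>
          \<Longrightarrow> polarization_map u t0 \<circ> f \<in> polarization_compositions"

end

theory Submission
  imports Defs
begin

text \<open>By compactness and injectivity of \<open>\<psi>\<close>, the diameters of the fibres of \<open>f k\<close> on the unit ball
  tend to \<open>0\<close>, and this passes to every initial segment of the composition. A composition of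
  polarizations with small fibres is a rigid motion on a slightly smaller ball: otherwise consider
  the first fold whose hyperplane cuts the part moved rigidly so far. It cuts only a small cap, and
  some point well beyond that cap has the same image as a point of the rigid part. Hence \<open>f k\<close> maps
  concentric balls of radius \<open>\<rho> < 1\<close> onto balls of the same radius for large \<open>k\<close>, and in the limit
  \<open>\<psi>\<close> maps the unit ball onto a unit ball.\<close>

section \<open>Single folds and their finite compositions\<close>

lemma dist_polarization_map_le:
  assumes "norm u = 1"
  shows "dist (polarization_map u t x) (polarization_map u t y) \<le> dist x y"
proof -
  define s s' where "s = t - x \<bullet> u" and "s' = t - y \<bullet> u"
  have uu: "u \<bullet> u = 1"
    using assms by (simp add: norm_eq_1)
  have expand: "(norm (z + m *\<^sub>R u))\<^sup>2 = (norm z)\<^sup>2 + 2 * m * (z \<bullet> u) + m\<^sup>2" for z m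
    unfolding power2_norm_eq_inner
    by (simp add: inner_add_left inner_add_right uu inner_commute power2_eq_square)
  \<comment> \<open>Orthogonally to \<open>u\<close> nothing changes; along \<open>u\<close> the
    signed distance to the hyperplane is replaced by its absolute value
    \<open>\<bar>s\<bar>\<close>. So the claim reduces to the absolute value being a contraction on
    the reals.\<close>
  have "(norm (x - y + ((\<bar>s\<bar> + s) - (\<bar>s'\<bar> + s')) *\<^sub>R u))\<^sup>2
      = (norm (x - y))\<^sup>2 + 2 * ((\<bar>s\<bar> + s) - (\<bar>s'\<bar> + s')) * (s' - s)
        + ((\<bar>s\<bar> + s) - (\<bar>s'\<bar> + s'))\<^sup>2"
    unfolding expand by (simp add: s_def s'_def inner_diff_left)
  also have "\<dots>
      = (norm (x - y))\<^sup>2 + ((\<bar>s\<bar> - \<bar>s'\<bar>)\<^sup>2 - (s - s')\<^sup>2)"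
    by (simp add: power2_eq_square algebra_simps)
  also have "\<dots> \<le> (norm (x - y))\<^sup>2"
    using abs_triangle_ineq3[of s s'] by (simp add: abs_le_square_iff)
  finally have "(norm (x - y + ((\<bar>s\<bar> + s) - (\<bar>s'\<bar> + s')) *\<^sub>R u))\<^sup>2 \<le> (norm (x - y))\<^sup>2" .
  then have "norm (x - y + ((\<bar>s\<bar> + s) - (\<bar>s'\<bar> + s')) *\<^sub>R u) \<le> norm (x - y)"
    by (rule power2_le_imp_le) simp
  moreover have "polarization_map u t x - polarization_map u t y
      = x - y + ((\<bar>s\<bar> + s) - (\<bar>s'\<bar> + s')) *\<^sub>R u"
    by (simp add: polarization_map_def s_def s'_def algebra_simps)
  ultimately show ?thesis
    by (simp add: dist_norm)
qed

lemma polarization_map_inner_ge: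
  assumes "norm u = 1"
  shows "t \<le> polarization_map u t x \<bullet> u"
proof -
  have "u \<bullet> u = 1"
    using assms by (simp add: norm_eq_1)
  then show ?thesis
    by (simp add: polarization_map_def inner_add_left)
qed

lemma polarization_map_eq_self: "t \<le> x \<bullet> u \<Longrightarrow> polarization_map u t x = x"
  by (simp add: polarization_map_def)

text \<open>Reduces a fold whose positive halfspace misses the origin to one whose positive
  halfspace contains it: opposite folds differ by the reflection in their common hyperplane, so they
  have the same fibres.\<close>

lemma polarization_map_flip:
  fixes u x :: "'a::euclidean_space" and t :: real
  assumes "norm u = 1"
  defines "y \<equiv> polarization_map (-u) (-t) x"
  shows "polarization_map u t x = y - (2 * (y \<bullet> u - t)) *\<^sub>R u"
proof -
  have "u \<bullet> u = 1"
    using assms by (simp add: norm_eq_1)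
  then show ?thesis
    by (simp add: y_def polarization_map_def inner_add_left inner_diff_left abs_if algebra_simps
        flip: scaleR_add_left)
qed

text \<open>Lets the rigid motion accumulated so far be pulled out of the next fold, whose
  hyperplane is transported back by that motion.\<close>

lemma polarization_map_rigid:
  assumes "orthogonal_transformation A"
  shows "polarization_map (A u) t (b + A x) = b + A (polarization_map u (t - b \<bullet> A u) x)"
proof -
  have "linear A" and "A x \<bullet> A u = x \<bullet> u"
    using assms by (auto simp: orthogonal_transformation_def)
  then show ?thesis
    by (simp add: polarization_map_def inner_add_left linear_add linear_scale diff_diff_eq add.commute)
qed

lemma orthogonal_transformation_reflection:
  fixes u :: "'a::euclidean_space"
  assumes "norm u = 1"
  shows "orthogonal_transformation (\<lambda>x. x - (2 * (x \<bullet> u)) *\<^sub>R u)"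
proof -
  have "u \<bullet> u = 1"
    using assms by (simp add: norm_eq_1)
  then have "(x - (2 * (x \<bullet> u)) *\<^sub>R u) \<bullet> (y - (2 * (y \<bullet> u)) *\<^sub>R u) = x \<bullet> y" for x y
    by (simp add: inner_diff_left inner_diff_right inner_commute)
  moreover have "linear (\<lambda>x. x - (2 * (x \<bullet> u)) *\<^sub>R u)"
    by (intro linearI) (simp_all add: inner_add_left algebra_simps)
  ultimately show ?thesis
    unfolding orthogonal_transformation_def by blast
qed

lemma polarization_compositions_contraction:
  assumes "f \<in> polarization_compositions"
  shows "dist (f x) (f y) \<le> dist x y"
  using assms
proof induction
  case id
  then show ?case by simp
next
  case (comp f u t)
  then show ?case
    using dist_polarization_map_le order_trans by (metis comp_apply)
qed

section \<open>Large fibres caused by a fold that cuts the rigid part\<close>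

text \<open>If the halfspace cuts the ball of radius \<open>h\<close> only tangentially at \<open>h v\<close>, Brouwer's theorem
  on a small disc orthogonal to \<open>v\<close> beyond that point produces \<open>q\<close> with \<open>G q\<close> on the axis of \<open>v\<close>,
  where \<open>G\<close> is the identity.\<close>

lemma contraction_into_halfspace_fibre:
  fixes G :: "'a::euclidean_space \<Rightarrow> 'a"
  assumes v: "norm v = 1" and r: "0 < r" "r \<le> 1/100"
    and h: "1 - 5 * r\<^sup>2 \<le> h" "h < 1 - 4 * r\<^sup>2"
    and lip: "\<And>x y. dist (G x) (G y) \<le> dist x y"
    and idG: "\<And>x. norm x \<le> h \<Longrightarrow> G x = x"
    and half: "\<And>x. G x \<bullet> v \<le> h"
  obtains x y where "norm x \<le> 1" "norm y \<le> 1" "G x = G y" "2 * r\<^sup>2 < dist x y"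
proof -
  \<comment> \<open>The disc has height \<open>c\<close> along \<open>v\<close>: more than
    \<open>2 * r\<^sup>2\<close> above \<open>h\<close>, yet low enough to stay in the unit ball,
    since \<open>c\<^sup>2 + r\<^sup>2 = 1 - 3 * r\<^sup>2 + 4 * r\<^sup>2 *
    r\<^sup>2\<close>.\<close>
  define c where "c = 1 - 2 * r\<^sup>2"
  define proj where "proj y = y - (y \<bullet> v) *\<^sub>R v" for y
  define S where "S = {w. w \<bullet> v = 0} \<inter> cball 0 r"
  \<comment> \<open>A fixed point of \<open>F\<close> is a \<open>w\<close> for which
    \<open>G (c *\<^sub>R v + w)\<close> lies on the axis of \<open>v\<close>.\<close>
  define F where "F w = w - proj (G (c *\<^sub>R v + w))" for w
  have vv: "v \<bullet> v = 1"
    using v by (simp add: norm_eq_1)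
  have r2: "r\<^sup>2 \<le> r / 100" "0 < r\<^sup>2"
    using r by (auto simp: power2_eq_square)
  have r4: "r\<^sup>2 * r\<^sup>2 \<le> r\<^sup>2 / 10000"
    using r2 r mult_left_mono[of "r\<^sup>2" "1/10000" "r\<^sup>2"] by simp
  have hpos: "99/100 \<le> h"
    using h r2 r by linarith
  have ch: "2 * r\<^sup>2 < c - h" "c - h \<le> 3 * r\<^sup>2"
    using h by (auto simp: c_def)
  have projv: "proj y \<bullet> v = 0" for y
    by (simp add: proj_def inner_diff_left vv)
  \<comment> \<open>\<open>G\<close> fixes \<open>h *\<^sub>R v\<close>, which is within
    \<open>105/100 * r\<close> of every disc point, so \<open>G\<close> cannot lower such a point
    much below \<open>h\<close>; the gap \<open>c - h\<close> adds at most
    \<open>3/100 * r\<close>.\<close>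
  have bound_a: "c - G (c *\<^sub>R v + w) \<bullet> v \<le> 11/10 * r" if w: "w \<in> S" for w
  proof -
    define q where "q = c *\<^sub>R v + w"
    have w0: "w \<bullet> v = 0" "v \<bullet> w = 0" and wr: "norm w \<le> r"
      using w by (auto simp: S_def inner_commute)
    have "dist (G q) (h *\<^sub>R v) \<le> dist q (h *\<^sub>R v)"
      using lip[of q "h *\<^sub>R v"] idG[of "h *\<^sub>R v"] hpos v by simp
    have "(dist q (h *\<^sub>R v))\<^sup>2 = (c - h)\<^sup>2 + (norm w)\<^sup>2"
      unfolding dist_norm power2_norm_eq_inner q_def
      by (simp add: inner_add_left inner_add_right inner_diff_left inner_diff_right vv w0
          power2_eq_square algebra_simps)
    also have "\<dots> \<le> (3 * r\<^sup>2)\<^sup>2 + r\<^sup>2"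
      using ch r2 wr by (intro add_mono power_mono) auto
    also have "\<dots> \<le> (105/100 * r)\<^sup>2"
    proof -
      have "(3 * r\<^sup>2)\<^sup>2 = 9 * (r\<^sup>2 * r\<^sup>2)" "(105/100 * r)\<^sup>2 = 11025/10000 * r\<^sup>2"
        by (simp_all add: power2_eq_square)
      then show ?thesis
        using r4 r2 by linarith
    qed
    finally have "(dist q (h *\<^sub>R v))\<^sup>2 \<le> (105/100 * r)\<^sup>2" .
    then have "dist q (h *\<^sub>R v) \<le> 105/100 * r"
      by (rule power2_le_imp_le) (use r in simp)
    then have "norm (h *\<^sub>R v - G q) \<le> 105/100 * r"
      using \<open>dist (G q) (h *\<^sub>R v) \<le> dist q (h *\<^sub>R v)\<close> by (simp add: dist_norm norm_minus_commute)
    moreover have "(h *\<^sub>R v - G q) \<bullet> v \<le> norm (h *\<^sub>R v - G q)"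
      using norm_cauchy_schwarz[of "h *\<^sub>R v - G q" v] v by simp
    moreover have "(h *\<^sub>R v - G q) \<bullet> v = h - G q \<bullet> v"
      by (simp add: inner_diff_left vv)
    ultimately show ?thesis
      using ch r2 by (simp add: q_def)
  qed
  \<comment> \<open>The sideways displacement \<open>D\<close> of a disc point under
    \<open>G\<close> must have length at most \<open>r\<close>.\<close>
  have "F \<in> S \<rightarrow> S"
  proof
    fix w assume w: "w \<in> S"
    define q a D where "q = c *\<^sub>R v + w" and "a = G q \<bullet> v" and "D = proj (G q) - w"
    define d where "d = norm D"
    have w0: "w \<bullet> v = 0" "v \<bullet> w = 0" and wr: "norm w \<le> r"
      using w by (auto simp: S_def inner_commute)
    have Dv: "D \<bullet> v = 0" "v \<bullet> D = 0"
      by (auto simp: D_def inner_diff_left projv w0 inner_commute[of v])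
    have Gq: "G q = a *\<^sub>R v + (w + D)"
      by (simp add: D_def a_def proj_def)
    have "d \<le> r"
    proof (rule ccontr)
      assume "\<not> d \<le> r"
      then have d: "r < d" "0 < d"
        using r by auto
      \<comment> \<open>The 3-4-5 triangle puts \<open>z\<close> on the sphere of radius
        \<open>h\<close>, hence among the fixed points of \<open>G\<close>, on the side opposite to
        \<open>D\<close>. A shift by \<open>D\<close> raises the squared distance to
        \<open>z\<close> by a term \<open>2 * \<beta> * d\<close>, which the limited drop in height
        cannot make up for if \<open>d > r\<close>.\<close>
      define \<alpha> \<beta> where "\<alpha> = 4/5 * h" and "\<beta> = 3/5 * h"
      define z where "z = \<alpha> *\<^sub>R v - (\<beta> / d) *\<^sub>R D"
      have DD: "D \<bullet> D = d * d"
        by (simp add: d_def power2_eq_square flip: power2_norm_eq_inner)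
      have "(norm z)\<^sup>2 = h\<^sup>2"
        using d unfolding z_def power2_norm_eq_inner
        by (simp add: inner_diff_left inner_diff_right vv Dv DD \<alpha>_def \<beta>_def power2_eq_square)
      then have "norm z = h"
        using hpos by (simp add: power2_eq_iff_nonneg)
      then have "dist (G q) z \<le> dist q z"
        using lip[of q z] idG[of z] by simp
      then have "(norm (G q - z))\<^sup>2 \<le> (norm (q - z))\<^sup>2"
        by (simp add: dist_norm power_mono)
      moreover have "(norm (G q - z))\<^sup>2
          = (a - \<alpha>)\<^sup>2 + w \<bullet> w + d\<^sup>2 + \<beta>\<^sup>2 + 2 * (w \<bullet> D) + 2 * (\<beta> / d) * (w \<bullet> D) + 2 * \<beta> * d"
        unfolding Gq z_def power2_norm_eq_inner using d
        by (simp add: inner_add_left inner_add_right inner_diff_left inner_diff_right vv w0 Dv DD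
            inner_commute[of D w] power2_eq_square field_simps)
      moreover have "(norm (q - z))\<^sup>2 = (c - \<alpha>)\<^sup>2 + w \<bullet> w + \<beta>\<^sup>2 + 2 * (\<beta> / d) * (w \<bullet> D)"
        unfolding q_def z_def power2_norm_eq_inner using d
        by (simp add: inner_add_left inner_add_right inner_diff_left inner_diff_right vv w0 Dv DD
            inner_commute[of D w] power2_eq_square field_simps)
      ultimately have "d\<^sup>2 + 2 * (w \<bullet> D) + 2 * \<beta> * d \<le> (c - \<alpha>)\<^sup>2 - (a - \<alpha>)\<^sup>2"
        by linarith
      also have "\<dots> = (c - a) * (c + a - 2 * \<alpha>)"
        by (simp add: power2_eq_square algebra_simps)
      \<comment> \<open>From \<open>c \<le> 1\<close>, \<open>a \<le> h\<close> and
        \<open>h \<ge> 99/100\<close> the second factor is at most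
        \<open>1 - 3/5 * h \<le> 41/100\<close>.\<close>
      also have "\<dots> \<le> (11/10 * r) * (41/100)"
      proof -
        have "a \<le> h"
          unfolding a_def by (rule half)
        then have "0 \<le> c - a" "c - a \<le> 11/10 * r" "c + a - 2 * \<alpha> \<le> 41/100"
          using bound_a[OF w] ch r2 hpos by (auto simp: a_def q_def \<alpha>_def c_def)
        then have "(c - a) * (c + a - 2 * \<alpha>) \<le> (c - a) * (41/100)"
          by (intro mult_left_mono) auto
        also have "\<dots> \<le> (11/10 * r) * (41/100)"
          using \<open>c - a \<le> 11/10 * r\<close> by simp
        finally show ?thesis .
      qed
      finally have *: "d\<^sup>2 + 2 * (w \<bullet> D) + 2 * \<beta> * d \<le> (11/10 * r) * (41/100)" .
      have "- (w \<bullet> D) \<le> norm w * d"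
        using norm_cauchy_schwarz[of "-w" D] by (simp add: d_def)
      also have "\<dots> \<le> 1/100 * d"
        using wr r d by (intro mult_right_mono) auto
      finally have "- (w \<bullet> D) \<le> 1/100 * d" .
      moreover have "59/100 * d \<le> \<beta> * d"
        using hpos d by (intro mult_right_mono) (auto simp: \<beta>_def)
      ultimately have "116/100 * d \<le> (11/10 * r) * (41/100)"
        using * zero_le_power2[of d] by linarith
      then show False
        using d r by linarith
    qed
    then show "F w \<in> S"
      using w0 projv[of "G q"] norm_minus_commute[of "proj (G q)" w]
      by (simp add: S_def F_def inner_diff_left d_def D_def flip: q_def)
  qed
  moreover have "continuous_on S F"
  proof -
    have "1-lipschitz_on UNIV G"
      using lip by (intro lipschitz_onI) auto
    then have "continuous_on UNIV G"
      by (rule lipschitz_on_continuous_on)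
    then have "continuous_on S (\<lambda>w. G (c *\<^sub>R v + w))"
      by (rule continuous_on_compose2) (auto intro!: continuous_intros)
    then show ?thesis
      unfolding F_def proj_def by (intro continuous_intros)
  qed
  moreover have "compact S" "convex S" "S \<noteq> {}"
  proof -
    have "closed {w. w \<bullet> v = 0}" "convex {w. w \<bullet> v = 0}"
      using closed_hyperplane[of v 0] convex_hyperplane[of v 0] by (simp_all add: inner_commute)
    then show "compact S" "convex S"
      unfolding S_def by (auto intro: closed_Int_compact convex_Int)
    have "0 \<in> S"
      using r by (simp add: S_def)
    then show "S \<noteq> {}"
      by blast
  qed
  ultimately obtain w where w: "w \<in> S" "F w = w"
    using brouwer[of S F] by blast
  define q a where "q = c *\<^sub>R v + w" and "a = G q \<bullet> v"
  have Gq: "G q = a *\<^sub>R v"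
    using w(2) by (simp add: F_def proj_def a_def q_def)
  \<comment> \<open>With \<open>a\<close> between \<open>-h\<close> and \<open>h\<close>, the point
    \<open>a *\<^sub>R v\<close> is fixed by \<open>G\<close> and so shares a fibre with
    \<open>q\<close>. Their heights differ by at least \<open>c - h\<close>.\<close>
  have "a \<le> h"
    unfolding a_def by (rule half)
  moreover have "- h \<le> a"
    using bound_a[OF w(1)] ch r r2 hpos by (simp add: a_def q_def)
  ultimately have "norm (a *\<^sub>R v) \<le> h"
    using v by simp
  then have "G q = G (a *\<^sub>R v)" "norm (a *\<^sub>R v) \<le> 1"
    using Gq idG h r2 by auto
  moreover have "norm q \<le> 1"
  proof -
    have w0: "w \<bullet> v = 0" "v \<bullet> w = 0" and wr: "norm w \<le> r"
      using w by (auto simp: S_def inner_commute)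
    have "(norm q)\<^sup>2 = c\<^sup>2 + (norm w)\<^sup>2"
      unfolding power2_norm_eq_inner q_def
      by (simp add: inner_add_left inner_add_right vv w0 power2_eq_square)
    also have "\<dots> \<le> c\<^sup>2 + r\<^sup>2"
      using wr by (intro add_left_mono power_mono) auto
    also have "c\<^sup>2 + r\<^sup>2 \<le> 1\<^sup>2"
      using r4 r2 by (simp add: c_def power2_eq_square algebra_simps)
    finally have "(norm q)\<^sup>2 \<le> 1\<^sup>2" .
    then show ?thesis
      by (rule power2_le_imp_le[OF _ zero_le_one])
  qed
  moreover have "2 * r\<^sup>2 < dist q (a *\<^sub>R v)"
  proof -
    have "w \<bullet> v = 0"
      using w by (simp add: S_def)
    then have "(q - a *\<^sub>R v) \<bullet> v = c - a"
      by (simp add: q_def inner_diff_left inner_add_left vv)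
    moreover have "(q - a *\<^sub>R v) \<bullet> v \<le> norm (q - a *\<^sub>R v)"
      using norm_cauchy_schwarz[of "q - a *\<^sub>R v" v] v by simp
    ultimately show ?thesis
      using ch \<open>a \<le> h\<close> by (simp add: dist_norm)
  qed
  ultimately show ?thesis
    using that by blast
qed

text \<open>A thick cap cut off by the fold has its pole identified with a distant mirror image; a
  thin cap yields a large fibre by the Brouwer argument. The assumption \<open>t \<le> 0\<close>
  puts the origin in the positive halfspace.\<close>

lemma small_fibres_imp_no_cut:
  fixes g :: "'a::euclidean_space \<Rightarrow> 'a"
  assumes u: "norm u = 1" and r: "0 < r" "r \<le> 1/100" and t: "t \<le> 0"
    and lip: "\<And>x y. dist (g x) (g y) \<le> dist x y"
    and idg: "\<And>x. norm x \<le> 1 - 4 * r\<^sup>2 \<Longrightarrow> g x = x"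
    and fib: "\<And>x y. \<lbrakk>norm x \<le> 1; norm y \<le> 1; polarization_map u t (g x) = polarization_map u t (g y)\<rbrakk>
        \<Longrightarrow> dist x y < 2 * r\<^sup>2"
  shows "1 - 4 * r\<^sup>2 \<le> - t"
proof (rule ccontr)
  assume cut: "\<not> ?thesis"
  define \<rho> h where "\<rho> = 1 - 4 * r\<^sup>2" and "h = - t"
  have h: "h < \<rho>" "0 \<le> h"
    using t cut by (auto simp: \<rho>_def h_def)
  have r2: "0 < r\<^sup>2"
    using r by simp
  have uu: "u \<bullet> u = 1"
    using u by (simp add: norm_eq_1)
  \<comment> \<open>The pole of the smaller ball on the cut-off side and its mirror image are folded
    together. Their distance \<open>2 * (\<rho> - h)\<close> is therefore small, which forces
    \<open>h\<close> into the range of the thin-cap lemma.\<close>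
  have "dist ((- \<rho>) *\<^sub>R u) ((\<rho> - 2 * h) *\<^sub>R u) < 2 * r\<^sup>2"
  proof (rule fib)
    have n: "norm ((- \<rho>) *\<^sub>R u) \<le> \<rho>" "norm ((\<rho> - 2 * h) *\<^sub>R u) \<le> \<rho>"
      using h u by auto
    then show "norm ((- \<rho>) *\<^sub>R u) \<le> 1" "norm ((\<rho> - 2 * h) *\<^sub>R u) \<le> 1"
      using r2 unfolding \<rho>_def by linarith+
    have "g ((- \<rho>) *\<^sub>R u) = (- \<rho>) *\<^sub>R u" "g ((\<rho> - 2 * h) *\<^sub>R u) = (\<rho> - 2 * h) *\<^sub>R u"
      using n idg unfolding \<rho>_def by blast+
    moreover have "polarization_map u t ((- \<rho>) *\<^sub>R u) = (\<rho> - 2 * h) *\<^sub>R u"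
      using h by (simp add: polarization_map_def uu h_def algebra_simps flip: scaleR_add_left)
    moreover have "polarization_map u t ((\<rho> - 2 * h) *\<^sub>R u) = (\<rho> - 2 * h) *\<^sub>R u"
      using h by (intro polarization_map_eq_self) (simp add: uu h_def)
    ultimately show "polarization_map u t (g ((- \<rho>) *\<^sub>R u)) = polarization_map u t (g ((\<rho> - 2 * h) *\<^sub>R u))"
      by metis
  qed
  moreover have "dist ((- \<rho>) *\<^sub>R u) ((\<rho> - 2 * h) *\<^sub>R u) = 2 * (\<rho> - h)"
    using u h by (simp add: dist_norm flip: scaleR_diff_left scaleR_minus_left)
  ultimately have h': "1 - 5 * r\<^sup>2 \<le> h"
    by (simp add: \<rho>_def)
  \<comment> \<open>Here \<open>- u\<close> points into the cap, and the ball of radius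
    \<open>h\<close> lies in the positive halfspace, so the fold fixes it.\<close>
  obtain x y where "norm x \<le> 1" "norm y \<le> 1" "2 * r\<^sup>2 < dist x y"
    "(polarization_map u t \<circ> g) x = (polarization_map u t \<circ> g) y"
  proof (rule contraction_into_halfspace_fibre[of "- u" r h "polarization_map u t \<circ> g"])
    show "norm (- u) = 1" "0 < r" "r \<le> 1/100" "1 - 5 * r\<^sup>2 \<le> h" "h < 1 - 4 * r\<^sup>2"
      using u r h h' by (auto simp: \<rho>_def)
    show "dist ((polarization_map u t \<circ> g) x) ((polarization_map u t \<circ> g) y) \<le> dist x y" for x y
      using dist_polarization_map_le[OF u] lip order_trans by (metis comp_apply)
    show "(polarization_map u t \<circ> g) x = x" if "norm x \<le> h" for x
    proof -
      have "- (x \<bullet> u) \<le> norm x"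
        using norm_cauchy_schwarz[of "-x" u] u by simp
      then have "polarization_map u t x = x"
        using that by (intro polarization_map_eq_self) (simp add: h_def)
      then show ?thesis
        using that h idg by (simp add: \<rho>_def)
    qed
    show "(polarization_map u t \<circ> g) x \<bullet> - u \<le> h" for x
      using polarization_map_inner_ge[OF u, of t "g x"] by (simp add: h_def)
  qed blast
  then show False
    using fib[of x y] by auto
qed

section \<open>Rigidity of compositions with small fibres\<close>

text \<open>A further fold can only enlarge fibres, so the bound passes to the inner composition.
  The new hyperplane does not cut the rigid part, on which the fold thus acts as the identity or as
  a reflection.\<close>

lemma polarization_compositions_small_fibres_rigid:
  fixes f :: "'a::euclidean_space \<Rightarrow> 'a"
  assumes "f \<in> polarization_compositions" and r: "0 < r" "r \<le> 1/100"
    and "\<And>x y. \<lbrakk>norm x \<le> 1; norm y \<le> 1; f x = f y\<rbrakk> \<Longrightarrow> dist x y < 2 * r\<^sup>2"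
  shows "\<exists>A b. orthogonal_transformation A \<and> (\<forall>x. norm x \<le> 1 - 4 * r\<^sup>2 \<longrightarrow> f x = b + A x)"
  using assms(1,4)
proof induction
  case id
  show ?case
    by (intro exI[of _ "\<lambda>x. x"] exI[of _ 0]) simp
next
  case (comp f u t)
  from comp.IH comp.prems
  obtain A b where A: "orthogonal_transformation A"
    and fA: "\<And>x. norm x \<le> 1 - 4 * r\<^sup>2 \<Longrightarrow> f x = b + A x"
    by (metis comp_apply)
  define B where "B = inv A"
  have B: "orthogonal_transformation B"
    unfolding B_def using A by (rule orthogonal_transformation_inv)
  have AB: "A (B x) = x" and BA: "B (A x) = x" for x
    using orthogonal_transformation_bij[OF A]
    by (auto simp: B_def bij_is_surj surj_f_inv_f bij_is_inj)
  \<comment> \<open>Coordinates in which the rigid part stands still: \<open>g\<close> is the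
    identity on the smaller ball, and the next fold has normal \<open>w\<close> and offset
    \<open>s\<close>.\<close>
  define g w s where "g x = B (f x - b)" and "w = B u" and "s = t - b \<bullet> u" for x
  have w: "norm w = 1"
    using B \<open>norm u = 1\<close> by (simp add: w_def orthogonal_transformation_norm)
  have fg: "f x = b + A (g x)" for x
    by (simp add: g_def AB)
  have g_lip: "dist (g x) (g y) \<le> dist x y" for x y
  proof -
    have "g x - g y = B (f x - f y)"
      using B by (simp add: g_def orthogonal_transformation_linear flip: linear_diff)
    then have "dist (g x) (g y) = dist (f x) (f y)"
      using B by (simp add: dist_norm orthogonal_transformation_norm)
    then show ?thesis
      using polarization_compositions_contraction[OF comp.hyps(1)] by simp
  qed
  have g_id: "g x = x" if "norm x \<le> 1 - 4 * r\<^sup>2" for x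
    using fA[OF that] by (simp add: g_def BA)
  have Pf: "polarization_map u t (f x) = b + A (polarization_map w s (g x))" for x
    using polarization_map_rigid[OF A, of w t b "g x"] by (simp add: fg w_def AB s_def)
  have small: "- norm x \<le> x \<bullet> w" "x \<bullet> w \<le> norm x" for x
    using norm_cauchy_schwarz[of x w] norm_cauchy_schwarz[of "-x" w] w by auto
  show ?case
  proof (cases "s \<le> 0")
    case True
    have "1 - 4 * r\<^sup>2 \<le> - s"
      using comp.prems by (intro small_fibres_imp_no_cut[OF w r True g_lip g_id]) (auto simp: Pf)
    then have "polarization_map w s (g x) = x" if "norm x \<le> 1 - 4 * r\<^sup>2" for x
      using that small(1)[of x] g_id[OF that] by (simp add: polarization_map_eq_self)
    then show ?thesis
      using A by (intro exI[of _ A] exI[of _ b]) (simp add: Pf)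
  next
    case False
    \<comment> \<open>Now the centre is on the side folded away. The opposite fold has the same
      fibres and fixes the smaller ball, so the given fold reflects it.\<close>
    have "1 - 4 * r\<^sup>2 \<le> - (- s)"
    proof (rule small_fibres_imp_no_cut[of "- w", OF _ r _ g_lip g_id])
      fix x y assume xy: "norm x \<le> 1" "norm y \<le> 1"
        "polarization_map (- w) (- s) (g x) = polarization_map (- w) (- s) (g y)"
      then have "polarization_map w s (g x) = polarization_map w s (g y)"
        using polarization_map_flip[OF w] by metis
      then show "dist x y < 2 * r\<^sup>2"
        using comp.prems xy by (simp add: Pf)
    qed (use w False in auto)
    then have "polarization_map (- w) (- s) (g x) = x" if "norm x \<le> 1 - 4 * r\<^sup>2" for x
      using that small(2)[of x] g_id[OF that] by (simp add: polarization_map_eq_self)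
    then have refl: "polarization_map w s (g x) = (2 * s) *\<^sub>R w + (x - (2 * (x \<bullet> w)) *\<^sub>R w)"
      if "norm x \<le> 1 - 4 * r\<^sup>2" for x
      using that polarization_map_flip[OF w, of s "g x"] by (simp add: algebra_simps)
    have "orthogonal_transformation (A \<circ> (\<lambda>x. x - (2 * (x \<bullet> w)) *\<^sub>R w))"
      by (intro orthogonal_transformation_compose A orthogonal_transformation_reflection w)
    moreover have "(polarization_map u t \<circ> f) x
        = b + A ((2 * s) *\<^sub>R w) + (A \<circ> (\<lambda>x. x - (2 * (x \<bullet> w)) *\<^sub>R w)) x"
      if "norm x \<le> 1 - 4 * r\<^sup>2" for x
      using linear_add[OF orthogonal_transformation_linear[OF A]]
      by (simp only: Pf refl[OF that] comp_apply add.assoc)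
    ultimately show ?thesis
      by blast
  qed
qed

section \<open>Compactness and limits of contractions\<close>

lemma tendsto_contractions_moving_point:
  fixes f :: "nat \<Rightarrow> 'a::metric_space \<Rightarrow> 'b::metric_space"
  assumes "\<And>k x y. dist (f k x) (f k y) \<le> dist x y"
    and "(\<lambda>k. f k a) \<longlonglongrightarrow> l" and "x \<longlonglongrightarrow> a"
  shows "(\<lambda>k. f k (x k)) \<longlonglongrightarrow> l"
proof (rule metric_tendsto_imp_tendsto[where f = "\<lambda>k. dist (x k) a + dist (f k a) l" and a = 0])
  have "(\<lambda>k. dist (x k) a + dist (f k a) l) \<longlonglongrightarrow> 0 + 0"
    using assms(2,3) by (intro tendsto_add) (auto simp flip: tendsto_dist_iff)
  then show "(\<lambda>k. dist (x k) a + dist (f k a) l) \<longlonglongrightarrow> 0"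
    by simp
  have "dist (f k (x k)) l \<le> dist (x k) a + dist (f k a) l" for k
    using dist_triangle[of "f k (x k)" l "f k a"] assms(1)[of k "x k" a] by linarith
  then show "\<forall>\<^sub>F k in sequentially. dist (f k (x k)) l \<le> dist (dist (x k) a + dist (f k a) l) 0"
    by simp
qed

text \<open>Otherwise infinitely many \<open>f k\<close> identify pairs in \<open>K\<close> at
  distance at least \<open>e\<close>. A limit of such pairs keeps that distance, and
  \<open>\<psi>\<close> identifies it, against injectivity.\<close>

lemma eventually_small_fibres:
  fixes f :: "nat \<Rightarrow> 'a::metric_space \<Rightarrow> 'b::metric_space"
  assumes "compact K" and "inj_on \<psi> K" and "0 < e"
    and lip: "\<And>k x y. dist (f k x) (f k y) \<le> dist x y"
    and lim: "\<And>x. x \<in> K \<Longrightarrow> (\<lambda>k. f k x) \<longlonglongrightarrow> \<psi> x"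
  shows "\<forall>\<^sub>F k in sequentially. \<forall>x\<in>K. \<forall>y\<in>K. f k x = f k y \<longrightarrow> dist x y < e"
proof (rule ccontr)
  define P where "P k = (\<forall>x\<in>K. \<forall>y\<in>K. f k x = f k y \<longrightarrow> dist x y < e)" for k
  assume "\<not> ?thesis"
  then have "\<exists>\<^sub>F k in sequentially. \<not> P k"
    by (simp add: P_def not_eventually)
  then have "infinite {k. \<not> P k}"
    by (simp add: frequently_cofinite flip: cofinite_eq_sequentially)
  then obtain s :: "nat \<Rightarrow> nat" where s: "strict_mono s" "\<And>n. \<not> P (s n)"
    using infinite_enumerate by (metis mem_Collect_eq)
  then have "\<forall>n. \<exists>p. p \<in> K \<times> K \<and> f (s n) (fst p) = f (s n) (snd p) \<and> e \<le> dist (fst p) (snd p)"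
    by (force simp: P_def not_less)
  then obtain p where p: "\<And>n. p n \<in> K \<times> K" "\<And>n. f (s n) (fst (p n)) = f (s n) (snd (p n))"
    "\<And>n. e \<le> dist (fst (p n)) (snd (p n))"
    by metis
  have "compact (K \<times> K)"
    using \<open>compact K\<close> by (intro compact_Times)
  then obtain l q where l: "l \<in> K \<times> K" "strict_mono q" "(p \<circ> q) \<longlonglongrightarrow> l"
    using p(1) unfolding compact_def by metis
  obtain x y where xy: "l = (x, y)" "x \<in> K" "y \<in> K"
    using l by auto
  have px: "(\<lambda>n. fst (p (q n))) \<longlonglongrightarrow> x" and py: "(\<lambda>n. snd (p (q n))) \<longlonglongrightarrow> y"
    using tendsto_fst[OF l(3)] tendsto_snd[OF l(3)] by (auto simp: xy)
  have sub: "(\<lambda>n. f (s (q n)) z) \<longlonglongrightarrow> \<psi> z" if "z \<in> K" for z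
    using LIMSEQ_subseq_LIMSEQ[OF lim[OF that] strict_mono_o[OF s(1) l(2)]] by (simp add: o_def)
  have "(\<lambda>n. f (s (q n)) (fst (p (q n)))) \<longlonglongrightarrow> \<psi> x"
    by (rule tendsto_contractions_moving_point[OF lip sub px]) (rule xy)
  moreover have "(\<lambda>n. f (s (q n)) (snd (p (q n)))) \<longlonglongrightarrow> \<psi> y"
    by (rule tendsto_contractions_moving_point[OF lip sub py]) (rule xy)
  ultimately have "\<psi> x = \<psi> y"
    using p(2) LIMSEQ_unique by simp
  then have "x = y"
    using \<open>inj_on \<psi> K\<close> xy by (simp add: inj_on_eq_iff)
  moreover have "e \<le> dist x y"
    using tendsto_dist[OF px py] p(3) by (intro LIMSEQ_le_const) auto
  ultimately show False
    using \<open>0 < e\<close> by simp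
qed

section \<open>The image of the unit ball\<close>

theorem theorem7p1:
  fixes \<psi> :: "'a::euclidean_space \<Rightarrow> 'a"
    and f :: "nat \<Rightarrow> 'a \<Rightarrow> 'a"
  assumes "1-lipschitz_on UNIV \<psi>"
    and "\<And>k. f k \<in> polarization_compositions"
    and "\<And>x. x \<in> cball 0 1 \<Longrightarrow> (\<lambda>k. f k x) \<longlonglongrightarrow> \<psi> x"
    and "inj_on \<psi> (cball 0 1)"
  shows "emeasure lebesgue (\<psi> ` cball 0 1) = emeasure lebesgue (cball (0::'a) 1)"
proof -
  note lip = polarization_compositions_contraction[OF assms(2)]
  have "ball (\<psi> 0) 1 \<subseteq> \<psi> ` cball 0 1"
  proof
    fix y assume y: "y \<in> ball (\<psi> 0) 1"
    \<comment> \<open>The square root gives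
      \<open>4 * r\<^sup>2 \<le> 1 - dist (\<psi> 0) y\<close>, so \<open>y - \<psi> 0\<close> fits
      into the ball on which \<open>f k\<close> will be rigid.\<close>
    define r where "r = min (1/100) (sqrt ((1 - dist (\<psi> 0) y) / 4))"
    have r: "0 < r" "r \<le> 1/100"
      using y by (auto simp: r_def)
    have "r\<^sup>2 \<le> (sqrt ((1 - dist (\<psi> 0) y) / 4))\<^sup>2"
      using r(1) by (intro power_mono) (auto simp: r_def)
    then have y': "norm (y - \<psi> 0) \<le> 1 - 4 * r\<^sup>2"
      using y by (simp add: dist_norm norm_minus_commute)
    have "\<forall>\<^sub>F k in sequentially. \<forall>x\<in>cball 0 1. \<forall>y\<in>cball 0 1. f k x = f k y \<longrightarrow> dist x y < 2 * r\<^sup>2"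
      using r assms(3,4) lip by (intro eventually_small_fibres[where \<psi> = \<psi>]) auto
    then obtain N where *: "\<forall>k\<ge>N. \<forall>x\<in>cball 0 1. \<forall>y\<in>cball 0 1. f k x = f k y \<longrightarrow> dist x y < 2 * r\<^sup>2"
      unfolding eventually_sequentially by blast
    have N: "dist x y < 2 * r\<^sup>2" if "N \<le> k" "norm x \<le> 1" "norm y \<le> 1" "f k x = f k y" for k x y
      using *[rule_format, of k x y] that by simp
    \<comment> \<open>A rigid \<open>f k\<close> maps the smaller ball onto the ball of the same
      radius about \<open>f k 0\<close>, which contains \<open>y\<close> translated by
      \<open>f k 0 - \<psi> 0\<close>.\<close>
    have "\<exists>x\<in>cball 0 1. f k x = f k 0 + (y - \<psi> 0)" if k: "N \<le> k" for k
    proof -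
      obtain A b where A: "orthogonal_transformation A"
        and fA: "\<And>x. norm x \<le> 1 - 4 * r\<^sup>2 \<Longrightarrow> f k x = b + A x"
        using polarization_compositions_small_fibres_rigid[OF assms(2)[of k] r N[OF k]] by blast
      obtain x where x: "A x = y - \<psi> 0"
        using orthogonal_transformation_surj[OF A] by (metis surjD)
      then have "norm x \<le> 1 - 4 * r\<^sup>2"
        using y' orthogonal_transformation_norm[OF A, of x] by simp
      moreover have "f k 0 = b"
        using fA[of 0] A order_trans[OF norm_ge_zero y']
        by (simp add: orthogonal_transformation_linear linear_0)
      moreover have "norm x \<le> 1"
        using \<open>norm x \<le> 1 - 4 * r\<^sup>2\<close> by (rule order_trans) simp
      ultimately show ?thesis
        using fA[of x] x by (intro bexI[of _ x]) simp_all
    qed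
    then have "\<forall>n. \<exists>x\<in>cball 0 1. f (N + n) x = f (N + n) 0 + (y - \<psi> 0)"
      by simp
    then obtain x where x: "\<And>n. x n \<in> cball 0 1" "\<And>n. f (N + n) (x n) = f (N + n) 0 + (y - \<psi> 0)"
      by metis
    \<comment> \<open>A limit point \<open>l\<close> of these approximate preimages is an exact
      preimage of \<open>y\<close> under \<open>\<psi>\<close>.\<close>
    obtain l q where l: "l \<in> cball 0 1" "strict_mono q" "(x \<circ> q) \<longlonglongrightarrow> l"
      using x(1) compact_cball[of "0::'a" 1] unfolding compact_def by metis
    have m: "strict_mono (\<lambda>n. N + q n)"
      using l(2) by (simp add: strict_mono_def)
    have sub: "(\<lambda>n. f (N + q n) z) \<longlonglongrightarrow> \<psi> z" if "z \<in> cball 0 1" for z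
      using LIMSEQ_subseq_LIMSEQ[OF assms(3)[OF that] m] by (simp add: o_def)
    have "(\<lambda>n. f (N + q n) (x (q n))) \<longlonglongrightarrow> \<psi> l"
      using l(3) by (intro tendsto_contractions_moving_point[OF lip sub[OF l(1)]]) (simp add: o_def)
    moreover have "(\<lambda>n. f (N + q n) 0 + (y - \<psi> 0)) \<longlonglongrightarrow> \<psi> 0 + (y - \<psi> 0)"
      by (intro tendsto_add sub) auto
    ultimately have "\<psi> l = y"
      using x(2) LIMSEQ_unique by fastforce
    then show "y \<in> \<psi> ` cball 0 1"
      using l(1) by blast
  qed
  moreover have "compact (\<psi> ` cball 0 1)"
    using lipschitz_on_continuous_on[OF assms(1)] continuous_on_subset
    by (intro compact_continuous_image) auto
  ultimately have "cball (\<psi> 0) 1 \<subseteq> \<psi> ` cball 0 1"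
    by (metis closure_ball closure_minimal compact_imp_closed zero_less_one)
  moreover have "\<psi> ` cball 0 1 \<subseteq> cball (\<psi> 0) 1"
    using lipschitz_onD[OF assms(1), of 0] by (force intro: order_trans)
  ultimately have "\<psi> ` cball 0 1 = cball (\<psi> 0) 1"
    by blast
  then show ?thesis
    by (simp add: emeasure_cball)
qed

end
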